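(* Let $a,b \in (0,1)$ be real numbers with $a \neq b$. Then \[ \sum_{n=0}^{\infty}\mathcal{L}\left(\frac{ab(a-b)^2(1-a)^n(1-b)^n}{\bigl(a(1-b)^{n+1}-b(1-a)^{n+1}\bigr)^2}\right) = \mathcal{L}(a) + \mathcal{L}(b) - \mathcal{L}\left(\frac{|a-b|}{1-\min(a,b)}\right). \]
   Context: $\mathcal{L}$ denotes the Rogers dilogarithm: for $0<x<1$, $\mathcal{L}(x) = \mathrm{Li}_2(x) + \frac{1}{2}\log(x)\log(1-x)$, where $\mathrm{Li}_2(x)=\sum_{n\ge1} x^n/n^2$; it is extended to $[0,1]$ by $\mathcal{L}(0)=0$ and $\mathcal{L}(1)=\pi^2/6$. *)

theory Defs
  imports "HOL-Analysis.Analysis"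
begin

definition Li2 :: "real \<Rightarrow> real" where
  "Li2 x = (\<Sum>n. x ^ Suc n / (real (Suc n))\<^sup>2)"

(* The Rogers dilogarithm on [0,1]; values outside this interval carry no meaning. *)
definition rogers_dilog :: "real \<Rightarrow> real" where
  "rogers_dilog x =
     (if x = 0 then 0
      else if x = 1 then pi\<^sup>2 / 6
      else Li2 x + ln x * ln (1 - x) / 2)"

end

theory Submission
  imports Defs "HOL-Real_Asymp.Real_Asymp"
begin

text \<open>Abel's five-term relation, applied to \<open>(x, y)\<close>, splits off the term
\<open>\<L>(x y)\<close> and replaces \<open>(x, y)\<close> by
\<open>(x (1 - y) / (1 - x y), y (1 - x) / (1 - x y))\<close>. This map preserves
\<open>r = (1 - x) / (1 - y)\<close> and multiplies \<open>y / x\<close> by \<open>r\<close>. With \<open>b < a\<close> the orbit of \<open>(a, b)\<close> therefore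
tends to \<open>(1 - r, 0)\<close>, where \<open>1 - r = (a - b) / (1 - b)\<close>, and the sum telescopes.\<close>

text \<open>The derivative stays a series because the closed form \<open>- ln (1 - x) / x\<close>
  evaluates to 0 at x = 0, where the true derivative is 1. That point is needed for continuity at
  0.\<close>

lemma Li2_has_real_derivative:
  assumes "\<bar>x\<bar> < 1"
  shows "(Li2 has_real_derivative (\<Sum>n. x ^ n / real (Suc n))) (at x)"
proof -
  \<comment> \<open>Division by zero gives \<open>c 0 = 0\<close>, so this power series has no
    constant term and agrees with \<open>Li2\<close> after an index shift.\<close>
  define c :: "nat \<Rightarrow> real" where "c n = 1 / (real n)\<^sup>2" for n
  have bound: "norm (c n) \<le> 1" for n
    by (cases n) (auto simp: c_def divide_simps power2_eq_square intro: mult_ge1_I)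
  have summable: "summable (\<lambda>n. c n * y ^ n)" if "norm y < 1" for y :: real
  proof (rule summable_comparison_test')
    show "summable (\<lambda>n. \<bar>y\<bar> ^ n)"
      using that by (simp add: summable_geometric)
    show "norm (c n * y ^ n) \<le> \<bar>y\<bar> ^ n" for n
      using bound[of n] by (simp add: abs_mult power_abs mult_left_le_one_le)
  qed
  have Li2_eq: "Li2 y = (\<Sum>n. c n * y ^ n)" if "norm y < 1" for y
    using suminf_split_initial_segment[OF summable[OF that], of 1]
    by (simp add: Li2_def c_def)
  have "((\<lambda>y. \<Sum>n. c n * y ^ n) has_real_derivative (\<Sum>n. diffs c n * x ^ n)) (at x)"
    by (rule termdiffs_strong'[where K = 1]) (use summable assms in auto)
  moreover have "diffs c n * x ^ n = x ^ n / real (Suc n)" for n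
    unfolding diffs_def c_def by (simp add: power2_eq_square)
  ultimately have "((\<lambda>y. \<Sum>n. c n * y ^ n) has_real_derivative (\<Sum>n. x ^ n / real (Suc n))) (at x)"
    by simp
  then show ?thesis
    by (rule DERIV_cong_ev[THEN iffD1, rotated -1, OF _ refl _ refl])
      (use assms Li2_eq in \<open>auto intro!: eventually_mono[OF eventually_nhds_in_open[of "ball 0 1"]]\<close>)
qed

lemma suminf_power_over_Suc:
  assumes "0 < x" "x < 1"
  shows "(\<Sum>n. x ^ n / real (Suc n)) = - ln (1 - x) / x"
proof -
  have "ln (1 - x) = (\<Sum>n. (-1) ^ n * (1 / real (n + 1)) * (1 - x - 1) ^ Suc n)"
    using assms by (intro ln_series) auto
  also have "\<dots> = (\<Sum>n. - x * (x ^ n / real (Suc n)))"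
  proof (rule suminf_cong)
    fix n
    have "(- 1) ^ n * (- x) ^ n = x ^ n"
      by (simp flip: power_mult_distrib)
    then show "(-1) ^ n * (1 / real (n + 1)) * (1 - x - 1) ^ Suc n = - x * (x ^ n / real (Suc n))"
      by simp
  qed
  also have "\<dots> = - x * (\<Sum>n. x ^ n / real (Suc n))"
  proof (rule suminf_mult, rule summable_comparison_test')
    show "summable (\<lambda>n. x ^ n)"
      using assms by (simp add: summable_geometric)
    show "norm (x ^ n / real (Suc n)) \<le> x ^ n" for n
      using assms by (simp add: field_simps)
  qed
  finally show ?thesis
    using assms by (simp add: field_simps)
qed

text \<open>The product of logarithms cancels half of the derivative of \<open>Li2\<close>. What
  remains is invariant under x -> 1 - x and involves only ln x and ln (1 - x) with rational
  coefficients, so the five-term relation becomes an algebraic check.\<close>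

lemma rogers_dilog_has_real_derivative:
  assumes "0 < x" "x < 1"
  shows "(rogers_dilog has_real_derivative - (ln (1 - x) / x + ln x / (1 - x)) / 2) (at x)"
proof -
  have Li2: "(Li2 has_real_derivative - ln (1 - x) / x) (at x)"
    using Li2_has_real_derivative[of x] suminf_power_over_Suc assms by simp
  have "((\<lambda>x. Li2 x + ln x * ln (1 - x) / 2) has_real_derivative
      - (ln (1 - x) / x + ln x / (1 - x)) / 2) (at x)"
    using assms by (auto intro!: derivative_eq_intros Li2 simp: field_simps)
  then show ?thesis
    by (rule DERIV_cong_ev[THEN iffD1, rotated -1, OF _ refl _ refl])
      (use assms in \<open>auto simp: rogers_dilog_def
        intro!: eventually_mono[OF eventually_nhds_in_open[of "{0<..<1}"]]\<close>)
qed

text \<open>The endpoint 0 is used twice: as the base point for the five-term relation, and as the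
  limit of the second orbit coordinate. Near 0, ln (1 - x) decays like x and beats the divergence of
  ln x.\<close>

lemma continuous_on_rogers_dilog: "continuous_on {0..<1} rogers_dilog"
proof (subst continuous_on_eq_continuous_within, intro ballI)
  fix x :: real assume x: "x \<in> {0..<1}"
  show "continuous (at x within {0..<1}) rogers_dilog"
  proof (cases "x = 0")
    case False
    with x show ?thesis
      using rogers_dilog_has_real_derivative[of x]
      by (auto intro: continuous_at_imp_continuous_at_within DERIV_isCont)
  next
    case True
    have "isCont Li2 0"
      using Li2_has_real_derivative[of 0] by (auto intro: DERIV_isCont)
    then have "(Li2 \<longlongrightarrow> 0) (at_right 0)"
      by (auto simp: isCont_def Li2_def intro: tendsto_within_subset)
    moreover have "((\<lambda>x::real. ln x * ln (1 - x) / 2) \<longlongrightarrow> 0) (at_right 0)"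
      by real_asymp
    ultimately have "((\<lambda>x. Li2 x + ln x * ln (1 - x) / 2) \<longlongrightarrow> 0 + 0) (at_right 0)"
      by (rule tendsto_add)
    moreover have "eventually (\<lambda>x. Li2 x + ln x * ln (1 - x) / 2 = rogers_dilog x) (at_right 0)"
      using eventually_at_right_real[of 0 1]
      by (rule eventually_mono) (auto simp: rogers_dilog_def)
    ultimately have "(rogers_dilog \<longlongrightarrow> 0) (at_right 0)"
      by (auto intro: Lim_transform_eventually)
    moreover have "at 0 within {0..<1} = at_right (0::real)"
      by (rule at_within_nhd[of _ "{-1<..<1}"]) auto
    ultimately show ?thesis
      by (simp add: True continuous_within rogers_dilog_def)
  qed
qed

text \<open>With y fixed and x replaced by a variable t, the difference \<open>G\<close> of the two
  sides vanishes at t = 0 and has zero derivative on (0, x).\<close>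

lemma rogers_dilog_five_term:
  assumes x: "0 < x" "x < 1" and y: "0 < y" "y < 1"
  shows "rogers_dilog x + rogers_dilog y =
    rogers_dilog (x * y) + rogers_dilog (x * (1 - y) / (1 - x * y))
      + rogers_dilog (y * (1 - x) / (1 - x * y))"
proof -
  define u v where "u t = t * (1 - y) / (1 - t * y)" and "v t = y * (1 - t) / (1 - t * y)" for t
  define G where "G t = rogers_dilog t + rogers_dilog y - rogers_dilog (t * y)
    - rogers_dilog (u t) - rogers_dilog (v t)" for t
  have ty: "t * y < 1" if "t < 1" for t
    using mult_strict_right_mono[OF that y(1)] y(2) by simp
  \<comment> \<open>These factorisations bound \<open>u\<close> and \<open>v\<close> below 1 and
    later split ln (1 - u) and ln (1 - v).\<close>
  have compl: "1 - u t = (1 - t) / (1 - t * y)" "1 - v t = (1 - y) / (1 - t * y)" if "t < 1" for t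
    using ty[OF that] by (simp_all add: u_def v_def field_simps)
  have uv: "0 \<le> u t" "u t < 1" "0 \<le> v t" "v t < 1" if "0 \<le> t" "t < 1" for t
  proof -
    have "0 < 1 - u t" "0 < 1 - v t"
      using ty that y by (simp_all add: compl)
    then show "0 \<le> u t" "u t < 1" "0 \<le> v t" "v t < 1"
      using ty[of t] that y by (simp_all add: u_def v_def)
  qed
  have "1 - t * y \<noteq> 0" if "t \<in> {0..x}" for t
    using ty[of t] that x by auto
  then have cont_uv: "continuous_on {0..x} u" "continuous_on {0..x} v"
    unfolding u_def v_def by (intro continuous_intros ballI; simp)+
  have "G x = G 0"
  proof (rule DERIV_isconst_end[OF x(1)])
    show "continuous_on {0..x} G"
      unfolding G_def using x y uv ty cont_uv
      by (intro continuous_intros continuous_on_compose2[OF continuous_on_rogers_dilog]) auto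
  next
    fix t assume "0 < t" "t < x"
    then have t: "0 < t" "t < 1"
      using x by auto
    note ty' = ty[OF t(2)]
    have pos: "0 < u t" "0 < v t"
      using t ty' y by (simp_all add: u_def v_def)
    have du: "(u has_real_derivative (1 - y) / (1 - t * y)\<^sup>2) (at t)"
      unfolding u_def using ty'
      by (auto intro!: derivative_eq_intros simp: field_simps power2_eq_square)
    have dv: "(v has_real_derivative - (y * (1 - y)) / (1 - t * y)\<^sup>2) (at t)"
      unfolding v_def using ty'
      by (auto intro!: derivative_eq_intros simp: field_simps power2_eq_square)
    have dty: "((\<lambda>t. t * y) has_real_derivative y) (at t)"
      by (auto intro!: derivative_eq_intros)
    note D = rogers_dilog_has_real_derivative[THEN DERIV_chain2]
    \<comment> \<open>All logarithms in the derivative of \<open>G\<close> are integer combinations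
      of these five, so it suffices that the rational coefficient of each one cancels.\<close>
    define X Y A B P where "X = ln t" and "Y = ln y" and "A = ln (1 - t)" and "B = ln (1 - y)"
      and "P = ln (1 - t * y)"
    have logs: "ln (t * y) = X + Y" "ln (u t) = X + B - P" "ln (1 - u t) = A - P"
      "ln (v t) = Y + A - P" "ln (1 - v t) = B - P"
      using t y ty' unfolding X_def Y_def A_def B_def P_def compl[OF t(2)]
      by (simp_all add: u_def v_def ln_mult ln_div)
    have quot: "(1 - y) / (1 - t * y)\<^sup>2 / u t = 1 / (t * (1 - t * y))"
      "(1 - y) / (1 - t * y)\<^sup>2 / (1 - u t) = (1 - y) / ((1 - t * y) * (1 - t))"
      "- (y * (1 - y)) / (1 - t * y)\<^sup>2 / v t = - (1 - y) / ((1 - t * y) * (1 - t))"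
      "- (y * (1 - y)) / (1 - t * y)\<^sup>2 / (1 - v t) = - y / (1 - t * y)"
      using t y ty' unfolding compl[OF t(2)]
      by (simp_all add: u_def v_def divide_simps power2_eq_square) (simp_all add: algebra_simps)?
    \<comment> \<open>The chain-rule factor is moved into each quotient, producing exactly the
      left-hand sides of \<open>quot\<close>.\<close>
    have deriv_form: "- (p / w + q / (1 - w)) / 2 * d = - (p * (d / w) + q * (d / (1 - w))) / 2"
      for p q w d :: real
      by (simp add: algebra_simps add_divide_distrib)
    have "(G has_real_derivative
        - (A / t + X / (1 - t)) / 2 + 0
        - (- (ln (1 - t * y) / (t * y) + ln (t * y) / (1 - t * y)) / 2 * y)
        - (- (ln (1 - u t) / u t + ln (u t) / (1 - u t)) / 2 * ((1 - y) / (1 - t * y)\<^sup>2))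
        - (- (ln (1 - v t) / v t + ln (v t) / (1 - v t)) / 2 * (- (y * (1 - y)) / (1 - t * y)\<^sup>2)))
        (at t)"
      unfolding G_def A_def X_def
      using t y pos ty' uv[of t]
      by (intro DERIV_add DERIV_diff DERIV_const D[OF _ _ du] D[OF _ _ dv] D[OF _ _ dty]
          rogers_dilog_has_real_derivative) auto
    moreover have "- (A / t + X / (1 - t)) / 2 + 0
        - (- (ln (1 - t * y) / (t * y) + ln (t * y) / (1 - t * y)) / 2 * y)
        - (- (ln (1 - u t) / u t + ln (u t) / (1 - u t)) / 2 * ((1 - y) / (1 - t * y)\<^sup>2))
        - (- (ln (1 - v t) / v t + ln (v t) / (1 - v t)) / 2 * (- (y * (1 - y)) / (1 - t * y)\<^sup>2)) = 0"
      unfolding deriv_form quot logs P_def[symmetric]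
    proof -
      \<comment> \<open>Partial fractions in t: every coefficient is linear in \<open>k\<close>,
        \<open>l\<close> and \<open>y * m\<close>, so the cancellation becomes a polynomial
        identity.\<close>
      define k l m where "k = 1 / t" and "l = 1 / (1 - t)" and "m = 1 / (1 - t * y)"
      have "1 / (t * (1 - t * y)) = k + y * m" "(1 - y) / ((1 - t * y) * (1 - t)) = l - y * m"
        "- (1 - y) / ((1 - t * y) * (1 - t)) = y * m - l"
        "- y / (1 - t * y) = - (y * m)" "y / (t * y) = k" "y / (1 - t * y) = y * m"
        "A / t = A * k" "X / (1 - t) = X * l"
        using t y ty' by (simp_all add: k_def l_def m_def divide_simps) (simp_all add: algebra_simps)?
      then show "- (A / t + X / (1 - t)) / 2 + 0
        - (- (P * (y / (t * y)) + (X + Y) * (y / (1 - t * y))) / 2)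
        - (- ((A - P) * (1 / (t * (1 - t * y))) + (X + B - P) * ((1 - y) / ((1 - t * y) * (1 - t)))) / 2)
        - (- ((B - P) * (- (1 - y) / ((1 - t * y) * (1 - t))) + (Y + A - P) * (- y / (1 - t * y))) / 2) = 0"
        by (simp only:) (simp add: algebra_simps add_divide_distrib diff_divide_distrib)
    qed
    ultimately show "(G has_real_derivative 0) (at t)"
      by simp
  qed
  \<comment> \<open>At t = 0 the arguments are u = 0 and v = y, and \<open>rogers_dilog 0\<close> is
    0.\<close>
  also have "G 0 = 0"
    by (simp add: G_def u_def v_def rogers_dilog_def)
  finally show ?thesis
    by (simp add: G_def u_def v_def)
qed

text \<open>Here q = y / x and r = (1 - x) / (1 - y) serve as coordinates for the pair (x, y). In
  them the five-term map is q -> q * r with r fixed, so its iterates are explicit.\<close>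

lemma rogers_dilog_step:
  fixes q r :: real
  assumes q: "0 < q" "q < 1" and r: "0 < r" "r < 1"
  shows "rogers_dilog (q * (1 - r)\<^sup>2 / (1 - q * r)\<^sup>2) =
    rogers_dilog ((1 - r) / (1 - q * r)) + rogers_dilog (q * (1 - r) / (1 - q * r))
    - (rogers_dilog ((1 - r) / (1 - q * r * r)) + rogers_dilog (q * r * (1 - r) / (1 - q * r * r)))"
proof -
  define x y where "x = (1 - r) / (1 - q * r)" and "y = q * (1 - r) / (1 - q * r)"
  have qr: "q * r < 1"
    using mult_strict_mono[OF q(2) r(2)] q r by simp
  have qrr: "q * r * r < 1"
    using mult_strict_mono[OF qr r(2)] r by simp
  have compl: "1 - x = r * (1 - q) / (1 - q * r)" "1 - y = (1 - q) / (1 - q * r)"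
    using qr by (simp_all add: x_def y_def field_simps)
  have "0 < 1 - x" "0 < 1 - y"
    unfolding compl using q r qr by simp_all
  moreover have "0 < x" "0 < y"
    using q r qr by (simp_all add: x_def y_def)
  moreover have xy: "x * y = q * (1 - r)\<^sup>2 / (1 - q * r)\<^sup>2"
    by (simp add: x_def y_def power2_eq_square)
  \<comment> \<open>The terms 2 q r cancel in (1 - q r)^2 - q (1 - r)^2. The resulting factor 1 - q
    then cancels against the one in \<open>1 - x\<close> and \<open>1 - y\<close>.\<close>
  moreover have "1 - x * y = (1 - q) * (1 - q * r * r) / (1 - q * r)\<^sup>2"
    unfolding xy using qr by (simp add: divide_simps) (simp add: algebra_simps power2_eq_square)
  then have "x * (1 - y) / (1 - x * y) = (1 - r) / (1 - q * r * r)"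
    "y * (1 - x) / (1 - x * y) = q * r * (1 - r) / (1 - q * r * r)"
    unfolding compl using q qr qrr by (simp_all add: x_def y_def power2_eq_square)
  ultimately show ?thesis
    using rogers_dilog_five_term[of x y] by (simp add: x_def y_def)
qed

lemma rogers_dilog_geometric_sums:
  fixes q r :: real
  assumes q: "0 < q" "q < 1" and r: "0 < r" "r < 1"
  shows "(\<lambda>n. rogers_dilog (q * r ^ n * (1 - r)\<^sup>2 / (1 - q * r ^ Suc n)\<^sup>2)) sums
    (rogers_dilog ((1 - r) / (1 - q * r)) + rogers_dilog (q * (1 - r) / (1 - q * r))
      - rogers_dilog (1 - r))"
proof -
  \<comment> \<open>The sum of \<open>rogers_dilog\<close> over the two coordinates of the n-th
    orbit point, which has parameters q r^n and r.\<close>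
  define f where "f n = rogers_dilog ((1 - r) / (1 - q * r ^ Suc n))
    + rogers_dilog (q * r ^ n * (1 - r) / (1 - q * r ^ Suc n))" for n
  have qrn: "q * r ^ n < 1" for n
    using mult_left_le[of "r ^ n" q] power_le_one[of r n] q r by linarith
  have pow: "(\<lambda>n. r ^ n) \<longlonglongrightarrow> 0"
    using r by (intro LIMSEQ_realpow_zero) auto
  note pow_Suc = filterlim_compose[OF pow filterlim_Suc]
  have "(\<lambda>n. (1 - r) / (1 - q * r ^ Suc n)) \<longlonglongrightarrow> (1 - r) / (1 - q * 0)"
    by (intro tendsto_intros pow_Suc) auto
  moreover have "isCont rogers_dilog (1 - r)"
    using rogers_dilog_has_real_derivative[of "1 - r"] r by (auto intro: DERIV_isCont)
  ultimately have lim1: "(\<lambda>n. rogers_dilog ((1 - r) / (1 - q * r ^ Suc n))) \<longlonglongrightarrow> rogers_dilog (1 - r)"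
    using isCont_tendsto_compose[of "1 - r" rogers_dilog] by simp
  have y_lim: "(\<lambda>n. q * r ^ n * (1 - r) / (1 - q * r ^ Suc n)) \<longlonglongrightarrow> q * 0 * (1 - r) / (1 - q * 0)"
    by (intro tendsto_intros pow_Suc pow) auto
  \<comment> \<open>The limit 0 is an endpoint, where continuity is known only within {0..<1}, so
    the sequence must be shown to stay there. The other limit 1 - r is interior.\<close>
  have "q * r ^ n * (1 - r) / (1 - q * r ^ Suc n) \<in> {0..<1}" for n
    using q r qrn[of n] qrn[of "Suc n"] by (simp add: field_simps)
  then have lim2: "(\<lambda>n. rogers_dilog (q * r ^ n * (1 - r) / (1 - q * r ^ Suc n))) \<longlonglongrightarrow> rogers_dilog 0"
    using y_lim
    by (intro continuous_on_tendsto_compose[OF continuous_on_rogers_dilog] always_eventually) simp_all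
  have "f \<longlonglongrightarrow> rogers_dilog (1 - r) + rogers_dilog 0"
    unfolding f_def using lim1 lim2 by (rule tendsto_add)
  then have "(\<lambda>n. f n - f (Suc n)) sums (f 0 - rogers_dilog (1 - r))"
    by (intro telescope_sums') (simp add: rogers_dilog_def)
  moreover have "f n - f (Suc n) = rogers_dilog (q * r ^ n * (1 - r)\<^sup>2 / (1 - q * r ^ Suc n)\<^sup>2)" for n
    using rogers_dilog_step[of "q * r ^ n" r] q r qrn[of n] by (simp add: f_def mult_ac)
  ultimately show ?thesis
    by (simp add: f_def)
qed

lemma rogers_dilog_sums_less:
  fixes a b :: real
  assumes b: "0 < b" and ba: "b < a" and a: "a < 1"
  shows "(\<lambda>n. rogers_dilog
            (a * b * (a - b)\<^sup>2 * (1 - a) ^ n * (1 - b) ^ n /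
              (a * (1 - b) ^ (n + 1) - b * (1 - a) ^ (n + 1))\<^sup>2))
         sums (rogers_dilog a + rogers_dilog b - rogers_dilog ((a - b) / (1 - b)))"
proof -
  \<comment> \<open>These are the coordinates of the starting pair (a, b); b < a puts both of them
    in (0, 1).\<close>
  define q r where "q = b / a" and "r = (1 - a) / (1 - b)"
  have q: "0 < q" "q < 1" and r: "0 < r" "r < 1"
    using assms by (simp_all add: q_def r_def)
  have compl: "1 - r = (a - b) / (1 - b)" "1 - q * r = (a - b) / (a * (1 - b))"
    using assms by (simp_all add: q_def r_def field_simps)
  have start: "(1 - r) / (1 - q * r) = a" "q * (1 - r) / (1 - q * r) = b"
    unfolding compl using assms by (simp_all add: q_def)
  have "q * r ^ n * (1 - r)\<^sup>2 / (1 - q * r ^ Suc n)\<^sup>2 =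
    a * b * (a - b)\<^sup>2 * (1 - a) ^ n * (1 - b) ^ n /
      (a * (1 - b) ^ (n + 1) - b * (1 - a) ^ (n + 1))\<^sup>2" for n
  proof -
    define s t where "s = (1 - a) ^ n" and "t = (1 - b) ^ n"
    have t: "t > 0"
      using assms by (simp add: t_def)
    \<comment> \<open>The denominator \<open>a * (1 - b) * t\<close> appears here once and squared
      in the next identity, so it drops out of the quotient.\<close>
    have "1 - q * r ^ Suc n =
      (a * (1 - b) ^ (n + 1) - b * (1 - a) ^ (n + 1)) / (a * (1 - b) * t)"
      using assms t by (simp add: q_def r_def power_divide s_def t_def field_simps)
    moreover have "q * r ^ n * (1 - r)\<^sup>2 = a * b * (a - b)\<^sup>2 * s * t / (a * (1 - b) * t)\<^sup>2"
      unfolding compl using assms t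
      by (simp add: q_def r_def power_divide power_mult_distrib power2_eq_square mult_ac
          flip: s_def t_def)
    ultimately show ?thesis
      using assms t by (simp add: power_divide flip: s_def t_def)
  qed
  then show ?thesis
    using rogers_dilog_geometric_sums[OF q r] unfolding start by (simp add: compl(1))
qed

theorem theorem4:
  fixes a b :: real
  assumes "a \<in> {0<..<1}" and "b \<in> {0<..<1}" and "a \<noteq> b"
  shows "(\<lambda>n::nat. rogers_dilog
            (a * b * (a - b)\<^sup>2 * (1 - a) ^ n * (1 - b) ^ n /
              (a * (1 - b) ^ (n + 1) - b * (1 - a) ^ (n + 1))\<^sup>2))
         sums (rogers_dilog a + rogers_dilog b
               - rogers_dilog (\<bar>a - b\<bar> / (1 - min a b)))"
proof (cases "b < a")
  case True
  then show ?thesis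
    using rogers_dilog_sums_less[of b a] assms by simp
next
  case False
  \<comment> \<open>The base of the squared denominator only changes sign when a and b are
    exchanged, so the summand is symmetric and the case a < b follows from the other one.\<close>
  have swap: "a * (1 - b) ^ (n + 1) - b * (1 - a) ^ (n + 1) =
    - (b * (1 - a) ^ (n + 1) - a * (1 - b) ^ (n + 1))" for n
    by simp
  have "a < b"
    using False assms by simp
  then show ?thesis
    using rogers_dilog_sums_less[of a b] assms
    unfolding swap power2_minus by (simp add: mult_ac add_ac power2_commute[of b a])
qed

end
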